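(* Let $D$ be a $(v,k,\lambda_1,\lambda_2,m,n)$-divisible design digraph such that $\lambda_2>0$, and let $c=\max\{\lambda_1,\lambda_2\}$. If $k-c>\log v$, then $$\zeta(D)\le\dim(D)\le\left\lceil \frac{v\log v}{k-c}\right\rceil .$$
   Context: Digraphs are finite, without loops or multiple arcs; $\log$ is the natural logarithm. A digraph is $k$-regular if every vertex has in-degree and out-degree $k$, and asymmetric if no pair of vertices has arcs in both directions between them. A $k$-regular asymmetric digraph $D$ is a divisible design digraph with parameters $(v,k,\lambda_1,\lambda_2,m,n)$ if $D$ has $v$ vertices, which can be partitioned into $m$ classes of size $n$ such that the number of common in-neighbours and the number of common out-neighbours of any two distinct vertices in the same class are both $\lambda_1$, and for any two vertices from different classes are both $\lambda_2$. Distance $d(w,u)$ in a digraph is the length of a shortest directed path from $w$ to $u$, taken to be $\infty$ if there is none. A resolving set of $D$ is a set $R\subseteq V(D)$ such that for each pair of distinct vertices $x,y\notin R$ there is $w\in R$ with $d(w,x)\ne d(w,y)$. The metric dimension $\dim(D)$ is the least size of a resolving set. Localization game on $D$: one player controls a set of cops, the other an invisible robber. The robber first chooses an initial vertex. In each subsequent round the cops move (each cop may choose any vertex to occupy), and then the robber moves along an arc to an out-neighbour or stays. After each robber move, if the cops occupy $u_1,\dots,u_j$, they receive the vector of distances $d(u_i,x)$, $1\le i\le j$, where $x$ is the robber's vertex. The robber is located if in some round there is a unique vertex the robber can occupy that corresponds to the distance vector received (the cops may use information from previous rounds). The localization number $\zeta(D)$ is the minimum number of cops for which there is a strategy guaranteed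 to locate the robber in a finite number of rounds. *)

theory Defs
  imports
    Complex_Main
    "HOL-Library.Disjoint_Sets"
    "HOL-Library.Extended_Real"
    "Graph_Theory.Digraph"
    "Graph_Theory.Shortest_Path"
begin

section \<open>Divisible design digraphs\<close>

definition regular_digraph :: "('a, 'b) pre_digraph \<Rightarrow> nat \<Rightarrow> bool" where
  "regular_digraph D k \<longleftrightarrow> (\<forall>u\<in>verts D. in_degree D u = k \<and> out_degree D u = k)"

definition asymmetric_digraph :: "('a, 'b) pre_digraph \<Rightarrow> bool" where
  "asymmetric_digraph D \<longleftrightarrow>
     (\<forall>u\<in>verts D. \<forall>w\<in>verts D. \<not> (u \<rightarrow>\<^bsub>D\<^esub> w \<and> w \<rightarrow>\<^bsub>D\<^esub> u))"

definition common_in_neighbours :: "('a, 'b) pre_digraph \<Rightarrow> 'a \<Rightarrow> 'a \<Rightarrow> 'a set" where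
  "common_in_neighbours D x y = {w \<in> verts D. w \<rightarrow>\<^bsub>D\<^esub> x \<and> w \<rightarrow>\<^bsub>D\<^esub> y}"

definition common_out_neighbours :: "('a, 'b) pre_digraph \<Rightarrow> 'a \<Rightarrow> 'a \<Rightarrow> 'a set" where
  "common_out_neighbours D x y = {w \<in> verts D. x \<rightarrow>\<^bsub>D\<^esub> w \<and> y \<rightarrow>\<^bsub>D\<^esub> w}"

definition divisible_design_digraph ::
    "('a, 'b) pre_digraph \<Rightarrow> nat \<Rightarrow> nat \<Rightarrow> nat \<Rightarrow> nat \<Rightarrow> nat \<Rightarrow> nat \<Rightarrow> bool" where
  "divisible_design_digraph D v k lam\<^sub>1 lam\<^sub>2 m n \<longleftrightarrow>
     digraph D \<and> regular_digraph D k \<and> asymmetric_digraph D \<and> card (verts D) = v \<and>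
     (\<exists>P. partition_on (verts D) P \<and> card P = m \<and> (\<forall>C\<in>P. card C = n) \<and>
        (\<forall>C\<in>P. \<forall>x\<in>C. \<forall>y\<in>C. x \<noteq> y \<longrightarrow>
           card (common_in_neighbours D x y) = lam\<^sub>1 \<and>
           card (common_out_neighbours D x y) = lam\<^sub>1) \<and>
        (\<forall>C\<in>P. \<forall>C'\<in>P. C \<noteq> C' \<longrightarrow> (\<forall>x\<in>C. \<forall>y\<in>C'.
           card (common_in_neighbours D x y) = lam\<^sub>2 \<and>
           card (common_out_neighbours D x y) = lam\<^sub>2)))"

section \<open>Distance and metric dimension\<close>

text \<open>
  With unit arc weights, \<open>\<mu>\<close> is the infimum of the lengths of the walks from \<open>w\<close> to \<open>u\<close>, hence the
  length of a shortest path, and \<open>\<infinity>\<close> if there is none.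
\<close>

definition digraph_dist :: "('a, 'b) pre_digraph \<Rightarrow> 'a \<Rightarrow> 'a \<Rightarrow> ereal" where
  "digraph_dist D w u = wf_digraph.\<mu> D (\<lambda>_. 1) w u"

definition resolving_set :: "('a, 'b) pre_digraph \<Rightarrow> 'a set \<Rightarrow> bool" where
  "resolving_set D R \<longleftrightarrow> R \<subseteq> verts D \<and>
     (\<forall>x\<in>verts D - R. \<forall>y\<in>verts D - R. x \<noteq> y \<longrightarrow>
        (\<exists>w\<in>R. digraph_dist D w x \<noteq> digraph_dist D w y))"

definition metric_dim :: "('a, 'b) pre_digraph \<Rightarrow> nat" where
  "metric_dim D = (LEAST r. \<exists>R. resolving_set D R \<and> card R = r)"

section \<open>The localization game\<close>

text \<open>
  A play of the robber is given by his positions: \<open>x 0\<close> is the initial vertex and \<open>x t\<close> is his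
  vertex after his move in round \<open>t \<ge> 1\<close>. As all such sequences are considered, this covers
  every way in which the robber may choose his moves during the game.
\<close>

definition robber_plays :: "('a, 'b) pre_digraph \<Rightarrow> (nat \<Rightarrow> 'a) set" where
  "robber_plays D =
     {x. x 0 \<in> verts D \<and> (\<forall>t. x (Suc t) = x t \<or> x t \<rightarrow>\<^bsub>D\<^esub> x (Suc t))}"

text \<open>
  A strategy of the cops maps the list of distance vectors received in the previous rounds to
  the vertices that the cops occupy in the next round. It need not take their earlier positions
  as an argument, as these are determined by the strategy and the earlier vectors. Several cops
  may occupy the same vertex.
\<close>

type_synonym 'a cop_strategy = "ereal list list \<Rightarrow> 'a list"

definition cop_strategy :: "('a, 'b) pre_digraph \<Rightarrow> nat \<Rightarrow> 'a cop_strategy \<Rightarrow> bool" where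
  "cop_strategy D j \<sigma> \<longleftrightarrow> (\<forall>h. length (\<sigma> h) = j \<and> set (\<sigma> h) \<subseteq> verts D)"

primrec received :: "('a, 'b) pre_digraph \<Rightarrow> 'a cop_strategy \<Rightarrow> (nat \<Rightarrow> 'a) \<Rightarrow> nat \<Rightarrow> ereal list list"
where
  "received D \<sigma> x 0 = []"
| "received D \<sigma> x (Suc t) =
     received D \<sigma> x t @ [map (\<lambda>u. digraph_dist D u (x (Suc t))) (\<sigma> (received D \<sigma> x t))]"

text \<open>The vertices the robber can occupy after round \<open>t\<close>, given all information received so far.\<close>

definition possible_positions ::
    "('a, 'b) pre_digraph \<Rightarrow> 'a cop_strategy \<Rightarrow> (nat \<Rightarrow> 'a) \<Rightarrow> nat \<Rightarrow> 'a set" where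
  "possible_positions D \<sigma> x t =
     {y t | y. y \<in> robber_plays D \<and> received D \<sigma> y t = received D \<sigma> x t}"

definition locating_strategy :: "('a, 'b) pre_digraph \<Rightarrow> 'a cop_strategy \<Rightarrow> bool" where
  "locating_strategy D \<sigma> \<longleftrightarrow>
     (\<forall>x\<in>robber_plays D. \<exists>t\<ge>1. \<exists>z. possible_positions D \<sigma> x t = {z})"

definition localization_number :: "('a, 'b) pre_digraph \<Rightarrow> nat" where
  "localization_number D = (LEAST j. \<exists>\<sigma>. cop_strategy D j \<sigma> \<and> locating_strategy D \<sigma>)"

end

theory Submission
  imports Defs
begin

text \<open>
  The cops can simply stand on a minimum resolving set for ever: the first distance vector they
  receive already identifies the robber's vertex (\<open>localization_number_le_metric_dim\<close>).

  For the bound on the metric dimension, let \<open>x \<noteq> y\<close> be vertices. A vertex \<open>w\<close> with an arc to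
  exactly one of them resolves them, being at distance 1 from exactly one of them. By regularity
  and the design property the in-neighbourhoods of \<open>x\<close> and \<open>y\<close> both have size \<open>k\<close> and meet in at
  most \<open>c\<close> vertices, so at least \<open>2 * (k - c)\<close> vertices \<open>w\<close> resolve the pair in this way. It is
  enough to find a small set meeting the symmetric difference of the in-neighbourhoods for every
  pair. Choosing \<open>s\<close> vertices greedily, each meeting at least the average number of the sets not yet
  met, leaves at most \<open>v * (v - 1) * exp (- 2 * (k - c) * s / v)\<close> ordered pairs unresolved
  (\<open>greedy_hitting_set\<close>). For \<open>s \<ge> v * ln v / (k - c)\<close> this number is smaller than 1.
\<close>

section \<open>Greedy hitting sets\<close>

text \<open>
  Count the incidences between elements and sets in two ways: the sets contribute at least
  \<open>a * card I\<close> of them, so some element carries at least the average number.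
\<close>

lemma popular_element:
  fixes S :: "'i \<Rightarrow> 'a set" and a :: real
  assumes "finite V" "V \<noteq> {}" "finite I"
    and S: "\<And>i. i \<in> I \<Longrightarrow> S i \<subseteq> V" "\<And>i. i \<in> I \<Longrightarrow> a \<le> real (card (S i))"
  obtains w where "w \<in> V" "a * real (card I) / real (card V) \<le> real (card {i \<in> I. w \<in> S i})"
proof -
  let ?q = "a * real (card I) / real (card V)"
  have "\<exists>w\<in>V. ?q \<le> real (card {i \<in> I. w \<in> S i})"
  proof (rule ccontr)
    assume "\<not> ?thesis"
    then have "(\<Sum>w\<in>V. real (card {i \<in> I. w \<in> S i})) < (\<Sum>w\<in>V. ?q)"
      using assms by (intro sum_strict_mono) (auto simp: not_le)
    also have "\<dots> = a * real (card I)"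
      using assms by simp
    also have "\<dots> \<le> (\<Sum>i\<in>I. real (card (S i)))"
      using sum_mono[of I "\<lambda>_. a"] S by (simp add: mult.commute)
    also have "\<dots> = real (\<Sum>i\<in>I. card {w \<in> V. w \<in> S i})"
      unfolding of_nat_sum using S(1) by (intro sum.cong refl arg_cong[where f = "\<lambda>A. real (card A)"]) blast
    also have "(\<Sum>i\<in>I. card {w \<in> V. w \<in> S i}) = (\<Sum>w\<in>V. card {i \<in> I. w \<in> S i})"
      using assms by (intro sum_multicount_gen) auto
    finally show False
      by simp
  qed
  with that show thesis
    by blast
qed

text \<open>
  Adding an element that is popular among the missed sets multiplies their number by at most
  \<open>1 - a / card V \<le> exp (- a / card V)\<close>.
\<close>

lemma greedy_hitting_set:
  fixes S :: "'i \<Rightarrow> 'a set" and a :: real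
  assumes "finite V" "V \<noteq> {}" "finite I"
    and S: "\<And>i. i \<in> I \<Longrightarrow> S i \<subseteq> V" "\<And>i. i \<in> I \<Longrightarrow> a \<le> real (card (S i))"
  shows "\<exists>R\<subseteq>V. card R \<le> s \<and>
    real (card {i \<in> I. S i \<inter> R = {}}) \<le> real (card I) * exp (- (a * real s / real (card V)))"
proof (induction s)
  case 0
  show ?case
    by (intro exI[of _ "{}"]) simp
next
  case (Suc s)
  then obtain R where R: "R \<subseteq> V" "card R \<le> s"
    "real (card {i \<in> I. S i \<inter> R = {}}) \<le> real (card I) * exp (- (a * real s / real (card V)))"
    by blast
  let ?U = "{i \<in> I. S i \<inter> R = {}}"
  obtain w where w: "w \<in> V" "a * real (card ?U) / real (card V) \<le> real (card {i \<in> ?U. w \<in> S i})"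
    using popular_element[of V ?U S a] assms by auto
  have "{i \<in> I. S i \<inter> insert w R = {}} = ?U - {i \<in> ?U. w \<in> S i}"
    by auto
  then have "card {i \<in> I. S i \<inter> insert w R = {}} = card ?U - card {i \<in> ?U. w \<in> S i}"
    using \<open>finite I\<close> by (simp only:) (intro card_Diff_subset; auto)
  moreover have "card {i \<in> ?U. w \<in> S i} \<le> card ?U"
    using \<open>finite I\<close> by (intro card_mono) auto
  ultimately have "real (card {i \<in> I. S i \<inter> insert w R = {}})
      \<le> real (card ?U) - a * real (card ?U) / real (card V)"
    using w(2) by linarith
  also have "\<dots> = real (card ?U) * (1 + - (a / real (card V)))"
    by (simp add: right_diff_distrib)
  also have "\<dots> \<le> real (card ?U) * exp (- (a / real (card V)))"
    by (intro mult_left_mono exp_ge_add_one_self) simp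
  also have "\<dots> \<le> (real (card I) * exp (- (a * real s / real (card V)))) * exp (- (a / real (card V)))"
    by (intro mult_right_mono R(3)) simp
  also have "\<dots> = real (card I) * exp (- (a * real (Suc s) / real (card V)))"
    unfolding mult.assoc exp_add[symmetric]
    by (simp add: add_divide_distrib distrib_left)
  finally have "real (card {i \<in> I. S i \<inter> insert w R = {}})
      \<le> real (card I) * exp (- (a * real (Suc s) / real (card V)))" .
  moreover have "card (insert w R) \<le> Suc s"
    using R(2) card_insert_le_m1[of "Suc s" R w] by simp
  ultimately show ?case
    using w(1) R(1) by (intro exI[of _ "insert w R"]) auto
qed

section \<open>Distances 0 and 1\<close>

context wf_digraph
begin

lemma digraph_dist_le_walk_length:
  assumes "awalk u p w"
  shows "digraph_dist G u w \<le> ereal (real (length p))"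
  using min_cost_le_walk_cost[OF assms, of "\<lambda>_. 1"]
  by (simp add: digraph_dist_def awalk_cost_def sum_list_triv)

lemma digraph_dist_ge_walk_length:
  assumes "\<And>p. awalk u p w \<Longrightarrow> r \<le> length p"
  shows "ereal (real r) \<le> digraph_dist G u w"
  unfolding digraph_dist_def \<mu>_def
  using assms by (intro INF_greatest) (auto simp: awalk_cost_def sum_list_triv)

lemma digraph_dist_eq_0_iff:
  assumes "u \<in> verts G"
  shows "digraph_dist G u w = 0 \<longleftrightarrow> u = w"
proof
  assume "u = w"
  then show "digraph_dist G u w = 0"
    using digraph_dist_le_walk_length[of u "[]" w] digraph_dist_ge_walk_length[of u w 0] assms
    by (simp add: awalk_Nil_iff zero_ereal_def[symmetric] antisym)
next
  assume dist: "digraph_dist G u w = 0"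
  show "u = w"
  proof (rule ccontr)
    assume "u \<noteq> w"
    then have "1 \<le> length p" if "awalk u p w" for p
      using that by (cases p) (auto simp: awalk_Nil_iff)
    then have "ereal (real 1) \<le> digraph_dist G u w"
      by (intro digraph_dist_ge_walk_length)
    with dist show False
      by simp
  qed
qed

lemma digraph_dist_eq_1_iff:
  assumes "u \<in> verts G" "u \<noteq> w"
  shows "digraph_dist G u w = 1 \<longleftrightarrow> u \<rightarrow> w"
proof
  have pos: "1 \<le> length p" if "awalk u p w" for p
    using that assms by (cases p) (auto simp: awalk_Nil_iff)
  assume "u \<rightarrow> w"
  then obtain e where "e \<in> arcs G" "tail G e = u" "head G e = w"
    by (auto simp: arcs_ends_conv)
  then have "awalk u [e] w"
    by (auto simp: awalk_simps)
  then have "digraph_dist G u w \<le> ereal (real (length [e]))"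
    by (rule digraph_dist_le_walk_length)
  moreover have "ereal (real 1) \<le> digraph_dist G u w"
    using pos by (rule digraph_dist_ge_walk_length)
  ultimately have "digraph_dist G u w = ereal 1"
    by (intro antisym) simp_all
  then show "digraph_dist G u w = 1"
    by (simp only: one_ereal_def)
next
  assume dist: "digraph_dist G u w = 1"
  show "u \<rightarrow> w"
  proof (rule ccontr)
    assume no_arc: "\<not> u \<rightarrow> w"
    have "2 \<le> length p" if "awalk u p w" for p
    proof (cases p)
      case Nil
      then have "u = w"
        using that by (simp add: awalk_Nil_iff)
      with assms(2) show ?thesis ..
    next
      case (Cons e q)
      then have e: "e \<in> arcs G" "u = tail G e" "awalk (head G e) q w"
        using that by (simp_all add: awalk_Cons_iff)
      then have "u \<rightarrow> head G e"
        by (auto simp: arcs_ends_conv)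
      with no_arc e(3) have "q \<noteq> []"
        by (auto simp: awalk_Nil_iff)
      with Cons show ?thesis
        by (cases q) simp_all
    qed
    then have "ereal (real 2) \<le> digraph_dist G u w"
      by (intro digraph_dist_ge_walk_length)
    also have "digraph_dist G u w = ereal 1"
      using dist by (simp only: one_ereal_def)
    finally show False
      by simp
  qed
qed

end

section \<open>Localization by a resolving set\<close>

text \<open>
  A resolving set only has to separate the vertices outside it, but it separates its own members
  from everything else as well, since these are the only vertices at distance 0 from themselves.
\<close>

lemma (in wf_digraph) resolving_set_separates:
  assumes R: "resolving_set G R" and "x \<in> verts G" "y \<in> verts G"
    and eq: "\<And>w. w \<in> R \<Longrightarrow> digraph_dist G w x = digraph_dist G w y"
  shows "x = y"
proof (cases "x \<in> R \<or> y \<in> R")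
  case True
  show ?thesis
  proof (cases "x \<in> R")
    case True
    then have "digraph_dist G x y = digraph_dist G x x"
      by (intro eq[symmetric])
    also have "\<dots> = 0"
      using assms(2) by (simp add: digraph_dist_eq_0_iff)
    finally show ?thesis
      using assms(2) by (simp add: digraph_dist_eq_0_iff)
  next
    case False
    with \<open>x \<in> R \<or> y \<in> R\<close> have "digraph_dist G y x = digraph_dist G y y"
      by (intro eq) simp
    also have "\<dots> = 0"
      using assms(3) by (simp add: digraph_dist_eq_0_iff)
    finally show ?thesis
      using assms(3) by (simp add: digraph_dist_eq_0_iff)
  qed
next
  case False
  with assms show ?thesis
    unfolding resolving_set_def by blast
qed

lemma (in wf_digraph) robber_plays_in_verts:
  assumes "x \<in> robber_plays G"
  shows "x t \<in> verts G"
proof (induction t)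
  case 0
  with assms show ?case
    by (simp add: robber_plays_def)
next
  case (Suc t)
  have "x (Suc t) = x t \<or> x t \<rightarrow> x (Suc t)"
    using assms by (simp add: robber_plays_def)
  with Suc show ?case
    by (auto simp: arcs_ends_conv)
qed

lemma (in fin_digraph) metric_dim_attained:
  obtains R where "resolving_set G R" "card R = metric_dim G"
proof -
  have "resolving_set G (verts G)"
    by (simp add: resolving_set_def)
  then have "\<exists>r R. resolving_set G R \<and> card R = r"
    by blast
  then have "\<exists>R. resolving_set G R \<and> card R = metric_dim G"
    unfolding metric_dim_def by (rule LeastI_ex)
  with that show thesis
    by blast
qed

text \<open>
  The cops occupy a minimum resolving set in every round. The vector of the first round determines
  the robber's vertex, so he is located at \<open>t = 1\<close>.
\<close>

lemma (in fin_digraph) localization_number_le_metric_dim: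
  "localization_number G \<le> metric_dim G"
proof -
  obtain R where R: "resolving_set G R" "card R = metric_dim G"
    by (rule metric_dim_attained)
  then have sub: "R \<subseteq> verts G"
    by (simp add: resolving_set_def)
  then have "finite R"
    by (rule finite_subset) simp
  then obtain us where us: "set us = R" "length us = metric_dim G"
    using finite_distinct_list[of R] R(2) distinct_card by metis
  define \<sigma> :: "'a cop_strategy" where "\<sigma> = (\<lambda>_. us)"
  have "cop_strategy G (metric_dim G) \<sigma>"
    using us sub by (simp add: cop_strategy_def \<sigma>_def)
  moreover have "locating_strategy G \<sigma>"
    unfolding locating_strategy_def
  proof
    fix x assume x: "x \<in> robber_plays G"
    have "y 1 = x 1" if y: "y \<in> robber_plays G" and "received G \<sigma> y 1 = received G \<sigma> x 1" for y
    proof (rule resolving_set_separates[OF R(1)])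
      show "y 1 \<in> verts G" "x 1 \<in> verts G"
        using x y by (auto intro: robber_plays_in_verts)
      show "digraph_dist G w (y 1) = digraph_dist G w (x 1)" if "w \<in> R" for w
        using that us(1) \<open>received G \<sigma> y 1 = received G \<sigma> x 1\<close> by (auto simp: \<sigma>_def)
    qed
    then have "possible_positions G \<sigma> x 1 = {x 1}"
      using x unfolding possible_positions_def by blast
    then show "\<exists>t\<ge>1. \<exists>z. possible_positions G \<sigma> x t = {z}"
      by blast
  qed
  ultimately show ?thesis
    unfolding localization_number_def by (intro Least_le) blast
qed

section \<open>Separating vertices by their in-neighbourhoods\<close>

definition in_neighbours :: "('a, 'b) pre_digraph \<Rightarrow> 'a \<Rightarrow> 'a set" where
  "in_neighbours D x = {w \<in> verts D. w \<rightarrow>\<^bsub>D\<^esub> x}"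

lemma (in nomulti_digraph) card_in_neighbours: "card (in_neighbours G x) = in_degree G x"
proof -
  have "in_neighbours G x = tail G ` in_arcs G x"
    by (auto simp: in_neighbours_def arcs_ends_conv in_arcs_def)
  moreover have "inj_on (tail G) (in_arcs G x)"
    by (intro inj_onI no_multi_arcs) (auto simp: in_arcs_def arc_to_ends_def)
  ultimately show ?thesis
    by (simp add: in_degree_def card_image)
qed

lemma card_symmetric_difference:
  assumes "finite A" "finite B"
  shows "card ((A - B) \<union> (B - A)) + 2 * card (A \<inter> B) = card A + card B"
proof -
  have "card ((A - B) \<union> (B - A)) = card (A - B) + card (B - A)"
    using assms by (intro card_Un_disjoint) auto
  moreover have "card A = card (A \<inter> B) + card (A - B)" "card B = card (A \<inter> B) + card (B - A)"
    using card_Int_Diff[of A B] card_Int_Diff[of B A] assms by (auto simp: Int_commute)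
  ultimately show ?thesis
    by simp
qed

definition separators :: "('a, 'b) pre_digraph \<Rightarrow> 'a \<times> 'a \<Rightarrow> 'a set" where
  "separators D = (\<lambda>(x, y).
     (in_neighbours D x - in_neighbours D y) \<union> (in_neighbours D y - in_neighbours D x))"

text \<open>
  A resolving set concerns pairs \<open>x\<close>, \<open>y\<close> outside \<open>R\<close>, so a separator in \<open>R\<close> differs from both.
  For vertices other than itself distance 1 means having an arc to them, so the separator is at
  distance 1 from exactly one of \<open>x\<close> and \<open>y\<close>.
\<close>

lemma (in wf_digraph) resolving_setI_separators:
  assumes "R \<subseteq> verts G"
    and hit: "\<And>x y. x \<in> verts G \<Longrightarrow> y \<in> verts G \<Longrightarrow> x \<noteq> y \<Longrightarrow> separators G (x, y) \<inter> R \<noteq> {}"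
  shows "resolving_set G R"
  unfolding resolving_set_def
proof (intro conjI ballI impI)
  fix x y assume xy: "x \<in> verts G - R" "y \<in> verts G - R" "x \<noteq> y"
  then obtain w where w: "w \<in> R" "w \<in> separators G (x, y)"
    using hit[of x y] by blast
  then have "w \<in> verts G" "w \<noteq> x" "w \<noteq> y"
    using xy by (auto simp: separators_def in_neighbours_def)
  then have "(digraph_dist G w x = 1) \<noteq> (digraph_dist G w y = 1)"
    using w(2) by (auto simp: digraph_dist_eq_1_iff separators_def in_neighbours_def)
  with w(1) show "\<exists>w\<in>R. digraph_dist G w x \<noteq> digraph_dist G w y"
    by metis
qed fact

text \<open>
  Greedy hitting applies to the separators of all ordered pairs of distinct vertices. After \<open>s\<close>
  steps the factor \<open>exp (- 2 * b * s / v)\<close> is at most \<open>1 / v\<^sup>2\<close>, and there are fewer than \<open>v\<^sup>2\<close> such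
  pairs, so less than one pair, hence none, is left over.
\<close>

lemma (in fin_digraph) metric_dim_le_of_many_separators:
  assumes "0 < b"
    and many: "\<And>x y. x \<in> verts G \<Longrightarrow> y \<in> verts G \<Longrightarrow> x \<noteq> y \<Longrightarrow>
      2 * b \<le> real (card (separators G (x, y)))"
    and s: "real (card (verts G)) * ln (real (card (verts G))) / b \<le> real s"
  shows "metric_dim G \<le> s"
proof -
  let ?v = "real (card (verts G))"
  define I where "I = verts G \<times> verts G - Id"
  have "\<exists>R\<subseteq>verts G. card R \<le> s \<and> {i \<in> I. separators G i \<inter> R = {}} = {}"
  proof (cases "verts G = {}")
    case True
    then show ?thesis
      by (intro exI[of _ "{}"]) (simp add: I_def)
  next
    case False
    then have v: "0 < ?v"
      by (simp add: card_gt_0_iff)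
    have "finite I"
      by (simp add: I_def)
    have "\<exists>R\<subseteq>verts G. card R \<le> s \<and>
      real (card {i \<in> I. separators G i \<inter> R = {}}) \<le> real (card I) * exp (- (2 * b * real s / ?v))"
    proof (rule greedy_hitting_set)
      fix i assume "i \<in> I"
      then show "2 * b \<le> real (card (separators G i))"
        using many by (cases i) (simp add: I_def)
      show "separators G i \<subseteq> verts G"
        by (cases i) (auto simp: separators_def in_neighbours_def)
    qed (use False \<open>finite I\<close> in simp_all)
    then obtain R where R: "R \<subseteq> verts G" "card R \<le> s"
      "real (card {i \<in> I. separators G i \<inter> R = {}}) \<le> real (card I) * exp (- (2 * b * real s / ?v))"
      by blast
    \<comment> \<open>The diagonal is left out of \<open>I\<close>; this makes the final bound strict.\<close>
    have "I \<subset> verts G \<times> verts G"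
      using False by (auto simp: I_def)
    then have "card I < card (verts G) * card (verts G)"
      using psubset_card_mono[of "verts G \<times> verts G" I] by (simp add: card_cartesian_product)
    then have I: "real (card I) < ?v * ?v"
      by (simp only: of_nat_mult[symmetric] of_nat_less_iff)
    have "?v * ln ?v \<le> real s * b"
      using s \<open>0 < b\<close> by (simp only: pos_divide_le_eq)
    then have "2 * ln ?v \<le> 2 * b * real s / ?v"
      using v by (simp add: pos_le_divide_eq mult.commute)
    then have "exp (2 * ln ?v) \<le> exp (2 * b * real s / ?v)"
      by simp
    moreover have "exp (2 * ln ?v) = ?v * ?v"
      using v by (simp only: mult_2 exp_add exp_ln)
    ultimately have "real (card I) < exp (2 * b * real s / ?v)"
      using I by linarith
    then have "real (card I) * exp (- (2 * b * real s / ?v)) < 1"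
      by (simp add: exp_minus divide_inverse[symmetric])
    with R(3) have "card {i \<in> I. separators G i \<inter> R = {}} = 0"
      by linarith
    with \<open>finite I\<close> R(1,2) show ?thesis
      by auto
  qed
  then obtain R where R: "R \<subseteq> verts G" "card R \<le> s" "{i \<in> I. separators G i \<inter> R = {}} = {}"
    by blast
  have "resolving_set G R"
    using R(1,3) by (intro resolving_setI_separators) (auto simp: I_def)
  then have "metric_dim G \<le> card R"
    unfolding metric_dim_def by (intro Least_le) blast
  with R(2) show ?thesis
    by simp
qed

lemma divisible_design_digraph_common_in_neighbours_le:
  assumes "divisible_design_digraph D v k lam\<^sub>1 lam\<^sub>2 m n"
    and "x \<in> verts D" "y \<in> verts D" "x \<noteq> y"
  shows "card (common_in_neighbours D x y) \<le> max lam\<^sub>1 lam\<^sub>2"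
proof -
  obtain P where P: "partition_on (verts D) P"
    "\<forall>C\<in>P. \<forall>x\<in>C. \<forall>y\<in>C. x \<noteq> y \<longrightarrow> card (common_in_neighbours D x y) = lam\<^sub>1"
    "\<forall>C\<in>P. \<forall>C'\<in>P. C \<noteq> C' \<longrightarrow> (\<forall>x\<in>C. \<forall>y\<in>C'. card (common_in_neighbours D x y) = lam\<^sub>2)"
    using assms(1) unfolding divisible_design_digraph_def by meson
  obtain C C' where C: "C \<in> P" "x \<in> C" "C' \<in> P" "y \<in> C'"
    using assms(2,3) partition_onD1[OF P(1)] by blast
  show ?thesis
    using C P(2,3) assms(4) by (cases "C = C'") auto
qed

lemma divisible_design_digraph_separators:
  assumes D: "divisible_design_digraph D v k lam\<^sub>1 lam\<^sub>2 m n"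
    and xy: "x \<in> verts D" "y \<in> verts D" "x \<noteq> y"
  shows "2 * k \<le> card (separators D (x, y)) + 2 * max lam\<^sub>1 lam\<^sub>2"
proof -
  interpret digraph D
    using D by (simp add: divisible_design_digraph_def)
  have k: "card (in_neighbours D x) = k" "card (in_neighbours D y) = k"
    using D xy by (auto simp: card_in_neighbours divisible_design_digraph_def regular_digraph_def)
  have "in_neighbours D x \<inter> in_neighbours D y = common_in_neighbours D x y"
    by (auto simp: in_neighbours_def common_in_neighbours_def)
  then have "card (in_neighbours D x \<inter> in_neighbours D y) \<le> max lam\<^sub>1 lam\<^sub>2"
    using divisible_design_digraph_common_in_neighbours_le[OF D xy] by simp
  moreover have "finite (in_neighbours D x)" "finite (in_neighbours D y)"
    by (simp_all add: in_neighbours_def)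
  then have "card (separators D (x, y)) + 2 * card (in_neighbours D x \<inter> in_neighbours D y) = k + k"
    using card_symmetric_difference[of "in_neighbours D x" "in_neighbours D y"] k
    by (simp add: separators_def)
  ultimately show ?thesis
    by linarith
qed

theorem theorem2p10:
  fixes D :: "('a, 'b) pre_digraph"
    and v k lam\<^sub>1 lam\<^sub>2 m n c :: nat
  assumes "divisible_design_digraph D v k lam\<^sub>1 lam\<^sub>2 m n"
    and "lam\<^sub>2 > 0"
    and "c = max lam\<^sub>1 lam\<^sub>2"
    and "real k - real c > ln (real v)"
  shows "localization_number D \<le> metric_dim D \<and>
         int (metric_dim D) \<le> \<lceil>real v * ln (real v) / (real k - real c)\<rceil>"
proof -
  interpret digraph D
    using assms(1) by (simp add: divisible_design_digraph_def)
  have v: "card (verts D) = v"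
    using assms(1) by (simp add: divisible_design_digraph_def)
  \<comment> \<open>For the empty digraph this relies on the convention \<open>ln 0 = 0\<close>.\<close>
  have ln: "0 \<le> ln (real v)"
    by (cases "v = 0") auto
  then have pos: "0 < real k - real c"
    using assms(4) by linarith
  let ?q = "real v * ln (real v) / (real k - real c)"
  have "0 \<le> ?q"
    using ln pos by simp
  then have ceil: "0 \<le> \<lceil>?q\<rceil>"
    by linarith
  have "metric_dim D \<le> nat \<lceil>?q\<rceil>"
  proof (rule metric_dim_le_of_many_separators[OF pos])
    fix x y assume "x \<in> verts D" "y \<in> verts D" "x \<noteq> y"
    then have "2 * k \<le> card (separators D (x, y)) + 2 * c"
      using divisible_design_digraph_separators[OF assms(1)] assms(3) by simp
    then have "real (2 * k) \<le> real (card (separators D (x, y)) + 2 * c)"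
      by (simp only: of_nat_le_iff)
    then show "2 * (real k - real c) \<le> real (card (separators D (x, y)))"
      by simp
  next
    show "real (card (verts D)) * ln (real (card (verts D))) / (real k - real c)
        \<le> real (nat \<lceil>?q\<rceil>)"
      using v by (simp add: real_nat_ceiling_ge)
  qed
  then show ?thesis
    using localization_number_le_metric_dim ceil by linarith
qed

end
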